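(* Let $\mathcal P=(X,\prec)$ be a poset on $|X|=n$ elements, and let $\mathcal L$ be the set of feasible words of the corresponding poset antimatroid. Let $\omega:X\to\mathbb R_{>0}$ be a positive weight function satisfying $$\omega(x)\ \ge\ \sum_{y\in\mathrm{Cov}(x)}\omega(y)\qquad\text{for all }x\in X .$$ Then, for every integer $1\le k<n$, $$\mathrm L_\omega(k)^2\ \ge\ \mathrm L_\omega(k-1)\cdot \mathrm L_\omega(k+1).$$
   Context: Words are finite sequences of elements (letters) of $X$; a word is simple if no letter occurs twice. A simple word $\alpha$ is feasible if whenever $\alpha$ contains $x$ and $y\prec x$, the letter $y$ occurs in $\alpha$ before $x$. The poset antimatroid of $\mathcal P$ is $(X,\mathcal L)$ with $\mathcal L$ the set of all feasible words (including the empty word). $\mathrm{Cov}(x)$ is the set of elements $y$ covering $x$ (i.e. $x\prec y$ with no $z$ satisfying $x\prec z\prec y$). Put $\mathcal L_k=\{\alpha\in\mathcal L:|\alpha|=k\}$ where $|\alpha|$ is the length, $\omega(\alpha)=\prod_{x\in\alpha}\omega(x)$, and $\mathrm L_\omega(k)=\sum_{\alpha\in\mathcal L_k}\omega(\alpha)$. *)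

theory Defs
  imports Complex_Main
begin

text \<open>The strict order \<open>lt\<close> of a poset on \<open>X\<close> is only relevant on \<open>X\<close>; its values elsewhere
  are unconstrained and never consulted.\<close>

definition strict_poset :: "'a set \<Rightarrow> ('a \<Rightarrow> 'a \<Rightarrow> bool) \<Rightarrow> bool" where
  "strict_poset X lt \<longleftrightarrow> irreflp_on X lt \<and> transp_on X lt"

definition feasible :: "'a set \<Rightarrow> ('a \<Rightarrow> 'a \<Rightarrow> bool) \<Rightarrow> 'a list \<Rightarrow> bool" where
  "feasible X lt \<alpha> \<longleftrightarrow>
     (\<forall>i<length \<alpha>. \<forall>y\<in>X. lt y (\<alpha> ! i) \<longrightarrow> (\<exists>j<i. \<alpha> ! j = y))"

definition feasible_words :: "'a set \<Rightarrow> ('a \<Rightarrow> 'a \<Rightarrow> bool) \<Rightarrow> 'a list set" where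
  "feasible_words X lt = {\<alpha> \<in> lists X. distinct \<alpha> \<and> feasible X lt \<alpha>}"

definition Cov :: "'a set \<Rightarrow> ('a \<Rightarrow> 'a \<Rightarrow> bool) \<Rightarrow> 'a \<Rightarrow> 'a set" where
  "Cov X lt x = {y \<in> X. lt x y \<and> \<not> (\<exists>z\<in>X. lt x z \<and> lt z y)}"

definition word_weight :: "('a \<Rightarrow> real) \<Rightarrow> 'a list \<Rightarrow> real" where
  "word_weight \<omega> \<alpha> = (\<Prod>x\<leftarrow>\<alpha>. \<omega> x)"

definition L_weight :: "'a list set \<Rightarrow> ('a \<Rightarrow> real) \<Rightarrow> nat \<Rightarrow> real" where
  "L_weight \<L> \<omega> k = (\<Sum>\<alpha> | \<alpha> \<in> \<L> \<and> length \<alpha> = k. word_weight \<omega> \<alpha>)"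

text \<open>The sums in \<open>L_weight\<close> are genuine finite sums when \<open>X\<close> is finite.\<close>

lemma finite_feasible_words_length:
  assumes "finite X"
  shows "finite {\<alpha>. \<alpha> \<in> feasible_words X lt \<and> length \<alpha> = k}"
  by (rule finite_subset[OF _ finite_lists_length_eq[OF assms, of k]])
    (auto simp: feasible_words_def)

end

theory Submission
  imports Defs "HOL-Analysis.Function_Topology"
begin

text \<open>The proof is the combinatorial atlas argument of Chan and Pak. For a lower set \<open>S\<close>, let \<open>W m S\<close> be
  the total weight of the words of length \<open>m\<close> that continue a word with letter set \<open>S\<close>. There is a symmetric
  matrix, indexed by the letters available after \<open>S\<close> and one extra point, whose quadratic form takes
  the values \<open>W (m+2) S\<close>, \<open>W (m+1) S\<close>, \<open>W m S\<close> on two indicator vectors. Log-concavity is the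
  reverse Cauchy-Schwarz inequality for this form, i.e. the matrix has at most one positive
  eigenvalue. This goes by induction on \<open>m\<close>: the rows of the matrix are expressed by the forms of
  level \<open>m-1\<close> at \<open>S\<close> and at the sets \<open>insert x S\<close>, and the eigenvalues of a suitably
  normalised matrix are then at most 0 or at least 1, while 1 is the simple Perron eigenvalue. The weight
  condition is used only for \<open>m = 0\<close>.\<close>

subsection \<open>Hyperbolic symmetric matrices\<close>

definition mv :: "'i set \<Rightarrow> ('i \<Rightarrow> 'i \<Rightarrow> real) \<Rightarrow> ('i \<Rightarrow> real) \<Rightarrow> 'i \<Rightarrow> real" where
  "mv I M v r = (\<Sum>s\<in>I. M r s * v s)"

definition bil :: "'i set \<Rightarrow> ('i \<Rightarrow> 'i \<Rightarrow> real) \<Rightarrow> ('i \<Rightarrow> real) \<Rightarrow> ('i \<Rightarrow> real) \<Rightarrow> real" where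
  "bil I M u v = (\<Sum>r\<in>I. u r * mv I M v r)"

text \<open>Phrased as an inequality rather than by eigenvalues, so that it passes to limits of
  matrices and applies directly to indicator vectors.\<close>

definition hyperbolic :: "'i set \<Rightarrow> ('i \<Rightarrow> 'i \<Rightarrow> real) \<Rightarrow> bool" where
  "hyperbolic I M \<longleftrightarrow> (\<forall>f g. bil I M g g > 0 \<longrightarrow> bil I M f f * bil I M g g \<le> (bil I M f g)\<^sup>2)"

definition symmetric_matrix :: "'i set \<Rightarrow> ('i \<Rightarrow> 'i \<Rightarrow> real) \<Rightarrow> bool" where
  "symmetric_matrix I M \<longleftrightarrow> (\<forall>r\<in>I. \<forall>s\<in>I. M r s = M s r)"

lemma mv_lin: "mv I M (\<lambda>s. u s + c * v s) r = mv I M u r + c * mv I M v r"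
  by (simp add: mv_def algebra_simps sum.distrib sum_distrib_left)

lemma bil_lin_right: "bil I M w (\<lambda>s. u s + c * v s) = bil I M w u + c * bil I M w v"
  by (simp add: bil_def mv_lin algebra_simps sum.distrib sum_distrib_left)

lemma bil_lin_left: "bil I M (\<lambda>s. u s + c * v s) w = bil I M u w + c * bil I M v w"
  by (simp add: bil_def algebra_simps sum.distrib sum_distrib_left)

lemma bil_matrix_lin:
  "bil I (\<lambda>r s. a * M r s + b * N r s) u v = a * bil I M u v + b * bil I N u v"
  by (simp add: bil_def mv_def algebra_simps sum.distrib sum_distrib_left)

lemma bil_commute: "symmetric_matrix I M \<Longrightarrow> bil I M u v = bil I M v u"
  unfolding bil_def mv_def sum_distrib_left
  by (subst sum.swap) (auto simp: symmetric_matrix_def mult_ac intro!: sum.cong)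

lemma bil_scale_right: "bil I M w (\<lambda>s. c * v s) = c * bil I M w v"
  using bil_lin_right[of I M w "\<lambda>_. 0" c v] by (simp add: bil_def mv_def)

lemma bil_scale_left: "bil I M (\<lambda>s. c * v s) w = c * bil I M v w"
  using bil_lin_left[of I M "\<lambda>_. 0" c v w] by (simp add: bil_def mv_def)

lemma bil_square: 
  assumes "symmetric_matrix I M"
  shows "bil I M (\<lambda>s. u s + c * v s) (\<lambda>s. u s + c * v s)
    = bil I M u u + 2 * c * bil I M u v + c\<^sup>2 * bil I M v v"
  by (simp add: bil_lin_left bil_lin_right bil_commute[OF assms, of v u] power2_eq_square algebra_simps)

lemma bil_unit: "finite I \<Longrightarrow> r \<in> I \<Longrightarrow> bil I M (\<lambda>s. if s = r then 1 else 0) v = mv I M v r"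
  by (simp add: bil_def if_distrib[of "\<lambda>x. x * _"] cong: if_cong)

lemma quadratic_nonpos_imp_discriminant:
  fixes a b c x :: real
  assumes "a > 0" "c - 2 * x * b + x\<^sup>2 * a \<le> 0"
  shows "c * a \<le> b\<^sup>2"
proof -
  have "a * (c - 2 * x * b + x\<^sup>2 * a) \<le> 0"
    using assms by (simp add: mult_nonneg_nonpos)
  moreover have "a * (c - 2 * x * b + x\<^sup>2 * a) = c * a - b\<^sup>2 + (x * a - b)\<^sup>2"
    by (simp add: power2_eq_square algebra_simps)
  ultimately show ?thesis
    using zero_le_power2[of "x * a - b"] by linarith
qed

text \<open>A vector \<open>g\<close> with positive form lies off the hyperplane
  \<open>l = 0\<close>, so any \<open>f\<close> moves into it by subtracting a multiple of
  \<open>g\<close>; the nonpositive value there bounds the discriminant.\<close>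

lemma hyperbolicI:
  assumes sym: "symmetric_matrix I M"
    and lin: "\<And>f g c. l (\<lambda>s. f s + c * g s) = l f + c * (l g :: real)"
    and neg: "\<And>f. l f = 0 \<Longrightarrow> bil I M f f \<le> 0"
  shows "hyperbolic I M"
  unfolding hyperbolic_def
proof (intro allI impI)
  fix f g assume g: "bil I M g g > 0"
  then have "l g \<noteq> 0" using neg[of g] by auto
  define c where "c = l f / l g"
  have "l (\<lambda>s. f s + (- c) * g s) = 0"
    unfolding lin using \<open>l g \<noteq> 0\<close> by (simp add: c_def)
  from neg[OF this] have "bil I M f f - 2 * c * bil I M f g + c\<^sup>2 * bil I M g g \<le> 0"
    unfolding bil_square[OF sym] by simp
  then show "bil I M f f * bil I M g g \<le> (bil I M f g)\<^sup>2"
    using quadratic_nonpos_imp_discriminant[OF g] by blast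
qed

text \<open>Otherwise the linear term in \<open>e\<close> would beat the quadratic one for a
  suitable \<open>e\<close>. Semidefiniteness is asked only along one line because it will be known
  only on a hyperplane.\<close>

lemma psd_kernel:
  assumes sym: "symmetric_matrix I P"
    and psd: "\<And>e. 0 \<le> bil I P (\<lambda>s. u s + e * w s) (\<lambda>s. u s + e * w s)"
    and u: "bil I P u u = 0"
  shows "bil I P u w = 0"
proof (rule ccontr)
  assume b: "bil I P u w \<noteq> 0"
  let ?b = "bil I P u w" and ?q = "bil I P w w"
  have q: "0 \<le> 2 * e * ?b + e\<^sup>2 * ?q" for e
    using psd[of e] unfolding bil_square[OF sym] u by simp
  show False
  proof (cases "?q = 0")
    case True
    then show False using q[of "- ?b"] b by (auto simp: mult_le_0_iff)
  next
    case False
    have "0 \<le> ?q" using q[of 1] q[of "-1"] by simp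
    then have "?q > 0" using False by simp
    have "2 * (- ?b / ?q) * ?b + (- ?b / ?q)\<^sup>2 * ?q = - (?b\<^sup>2 / ?q)"
      using False by (simp add: field_simps power2_eq_square)
    moreover have "?b\<^sup>2 / ?q > 0" using b \<open>?q > 0\<close> by simp
    ultimately show False using q[of "- ?b / ?q"] by linarith
  qed
qed

section \<open>Eigenvectors by compactness\<close>

lemma compact_box:
  assumes "finite I"
  shows "compact {v :: 'i \<Rightarrow> real. \<forall>r. if r \<in> I then \<bar>v r\<bar> \<le> c r else v r = 0}"
proof -
  have "compactin (product_topology (\<lambda>_. euclidean) UNIV)
     (PiE UNIV (\<lambda>r. if r \<in> I then {- c r..c r} else {0::real}))"
    unfolding compactin_PiE by auto
  moreover have "(x \<in> (if r \<in> I then {- c r..c r} else {0})) = (if r \<in> I then \<bar>x\<bar> \<le> c r else x = 0)"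
    for x and r :: 'i by (cases "r \<in> I") (auto simp: abs_le_iff)
  then have "PiE UNIV (\<lambda>r. if r \<in> I then {- c r..c r} else {0::real})
      = {v. \<forall>r. if r \<in> I then \<bar>v r\<bar> \<le> c r else v r = 0}"
    by (simp only: PiE_UNIV_domain Pi_iff set_eq_iff mem_Collect_eq) simp
  ultimately show ?thesis
    by (simp add: euclidean_product_topology)
qed

lemma continuous_on_bil:
  "continuous_on A u \<Longrightarrow> continuous_on A v \<Longrightarrow> continuous_on A (\<lambda>x. bil I M (u x) (v x))"
  unfolding bil_def mv_def
  by (intro continuous_on_sum continuous_on_mult continuous_on_const) (rule continuous_on_product_then_coordinatewise, assumption)+

lemma bil_restrict: "bil I M (\<lambda>r. if r \<in> I then u r else 0) (\<lambda>r. if r \<in> I then v r else 0) = bil I M u v"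
  by (simp add: bil_def mv_def cong: sum.cong)

lemma bil_restrict_left: "bil I M (\<lambda>r. if r \<in> I then u r else 0) v = bil I M u v"
  by (simp add: bil_def mv_def cong: sum.cong)

text \<open>The eigenvector is a maximiser of the Rayleigh quotient, with respect to the inner product with
  weights \<open>D\<close>, on the hyperplane orthogonal to the known eigenvector \<open>h\<close>.\<close>

lemma exists_top_eigenvector:
  assumes fin: "finite I" and sym: "symmetric_matrix I M"
    and D: "\<And>r. r \<in> I \<Longrightarrow> D r > 0"
    and h: "\<And>r. r \<in> I \<Longrightarrow> mv I M h r = D r * h r"
    and hh: "bil I M h h > 0"
    and v: "bil I M v h = 0" "bil I M v v > 0"
  shows "\<exists>u e. e > 0 \<and> (\<forall>r\<in>I. mv I M u r = e * D r * u r) \<and> bil I M u h = 0 \<and> (\<exists>r\<in>I. u r \<noteq> 0)"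
proof -
  define nn where "nn w = (\<Sum>r\<in>I. D r * (w r)\<^sup>2)" for w :: "'a \<Rightarrow> real"
  have D0: "D r \<ge> 0" if "r \<in> I" for r using D[OF that] by simp
  have nn_nonneg: "nn w \<ge> 0" for w
    unfolding nn_def by (intro sum_nonneg mult_nonneg_nonneg) (auto simp: D0)
  have nn_pos: "nn w > 0" if "bil I M w w \<noteq> 0" for w
  proof (rule ccontr)
    assume "\<not> nn w > 0"
    then have "nn w = 0" using nn_nonneg[of w] by simp
    then have "\<forall>r\<in>I. D r * (w r)\<^sup>2 = 0"
      unfolding nn_def by (subst (asm) sum_nonneg_eq_0_iff) (auto simp: fin D0)
    then have "\<forall>r\<in>I. w r = 0" using D by force
    then show False using that by (simp add: bil_def)
  qed
  have nn_scale: "nn (\<lambda>r. c * w r) = c\<^sup>2 * nn w" for c w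
    by (simp add: nn_def sum_distrib_left power_mult_distrib mult_ac)
  \<comment> \<open>On \<open>nn w = 1\<close> each \<open>D r * (w r)^2\<close> is at most 1, hence
    this box. Vectors are total functions, so coordinates off \<open>I\<close> are pinned to 0 to
    get compactness.\<close>
  define B where "B = {w :: 'a \<Rightarrow> real. \<forall>r. if r \<in> I then \<bar>w r\<bar> \<le> sqrt (1 / D r) else w r = 0}"
  define K where "K = B \<inter> ({w. nn w = 1} \<inter> {w. bil I M w h = 0})"
  have cont_nn: "continuous_on UNIV nn"
    unfolding nn_def by (intro continuous_intros continuous_on_product_coordinates)
  have "closed ({w. nn w = 1} \<inter> {w. bil I M w h = 0})"
    by (intro closed_Int closed_Collect_eq cont_nn continuous_on_bil continuous_intros)
  then have "compact K" unfolding K_def B_def by (intro compact_Int_closed compact_box fin)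
  have B: "w \<in> B" if "nn w = 1" "\<And>r. r \<notin> I \<Longrightarrow> w r = 0" for w
  proof -
    have "\<bar>w r\<bar> \<le> sqrt (1 / D r)" if "r \<in> I" for r
    proof -
      have "D r * (w r)\<^sup>2 \<le> nn w" unfolding nn_def
        by (rule member_le_sum[of r I "\<lambda>r. D r * (w r)\<^sup>2"]) (auto simp: fin that D0)
      then have "(w r)\<^sup>2 \<le> 1 / D r" using D[OF that] \<open>nn w = 1\<close> by (simp add: field_simps)
      then show ?thesis using real_le_rsqrt real_sqrt_le_mono by fastforce
    qed
    then show ?thesis using that by (auto simp: B_def)
  qed
  define R where "R w = (\<lambda>r. if r \<in> I then w r / sqrt (nn w) else (0::real))" for w
  have nnR: "nn (R w) = 1" if "nn w > 0" for w
  proof -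
    have "nn (R w) = nn (\<lambda>r. (1 / sqrt (nn w)) * w r)"
      unfolding R_def nn_def by (intro sum.cong) auto
    then show ?thesis using that by (simp only: nn_scale) (simp add: power_divide)
  qed
  have bilR: "bil I M (R w) (R w) = bil I M w w / nn w" if "nn w > 0" for w
  proof -
    have "bil I M (R w) (R w) = bil I M (\<lambda>r. (1 / sqrt (nn w)) * w r) (\<lambda>r. (1 / sqrt (nn w)) * w r)"
      unfolding R_def by (subst bil_restrict[symmetric, of I M "\<lambda>r. (1 / sqrt (nn w)) * w r"]) (simp cong: if_cong)
    also have "\<dots> = bil I M w w / nn w"
      using that unfolding bil_scale_left bil_scale_right by simp
    finally show ?thesis .
  qed
  have RK: "R w \<in> K" if "nn w > 0" "bil I M w h = 0" for w
  proof -
    have "bil I M (R w) h = bil I M (\<lambda>r. (1 / sqrt (nn w)) * w r) h"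
      unfolding R_def by (subst bil_restrict_left[symmetric, of I M "\<lambda>r. (1 / sqrt (nn w)) * w r"]) (simp cong: if_cong)
    then have "bil I M (R w) h = 0" by (simp only: bil_scale_left that mult_zero_right)
    then show ?thesis unfolding K_def using nnR[OF that(1)] B[OF nnR[OF that(1)]] by (auto simp: R_def)
  qed
  have vpos: "nn v > 0" using nn_pos v by simp
  have "K \<noteq> {}" using RK[OF vpos v(1)] by auto
  have "continuous_on K (\<lambda>w. bil I M w w)"
    by (intro continuous_on_bil continuous_intros)
  then obtain u where u: "u \<in> K" "\<And>w. w \<in> K \<Longrightarrow> bil I M w w \<le> bil I M u u"
    using continuous_attains_sup[OF \<open>compact K\<close> \<open>K \<noteq> {}\<close>] by blast
  define e where "e = bil I M u u"
  have "e > 0"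
    using u(2)[OF RK[OF vpos v(1)]] bilR[OF vpos] v(2) vpos unfolding e_def
    by (smt (verit) divide_pos_pos)
  have uh: "bil I M u h = 0" and nnu: "nn u = 1" using u(1) by (auto simp: K_def)
  \<comment> \<open>As \<open>e\<close> is the maximal Rayleigh quotient, the form of
    \<open>P\<close> is nonnegative on the hyperplane and vanishes at \<open>u\<close>; by
    \<open>psd_kernel\<close> it pairs \<open>u\<close> to 0 with the whole hyperplane.\<close>
  define P where "P r s = (if r = s then e * D r else 0) - M r s" for r s
  have symP: "symmetric_matrix I P" using sym by (auto simp: symmetric_matrix_def P_def)
  have mvP: "mv I P w r = e * D r * w r - mv I M w r" if "r \<in> I" for w r
    using fin that by (simp add: mv_def P_def left_diff_distrib sum_subtractf
        if_distrib[of "\<lambda>x. x * _"] cong: if_cong)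
  have bilP: "bil I P w w' = e * (\<Sum>r\<in>I. D r * w r * w' r) - bil I M w w'" for w w'
    by (simp add: bil_def mvP right_diff_distrib sum_subtractf sum_distrib_left mult_ac)
  have psd: "bil I P w w \<ge> 0" if "bil I M w h = 0" for w
  proof (cases "bil I M w w > 0")
    case False
    then show ?thesis using nn_nonneg[of w] \<open>e > 0\<close>
      by (simp add: bilP nn_def power2_eq_square mult.assoc) (smt (verit) mult_nonneg_nonneg)
  next
    case True
    then have p: "nn w > 0" using nn_pos by simp
    from u(2)[OF RK[OF p that]] have "bil I M w w / nn w \<le> e" unfolding bilR[OF p] e_def .
    then have "bil I M w w \<le> e * nn w" using p by (simp add: field_simps)
    then show ?thesis by (simp add: bilP nn_def power2_eq_square mult.assoc)
  qed
  have uu: "bil I P u u = 0" using nnu by (simp add: bilP e_def nn_def power2_eq_square mult.assoc)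
  have ker: "bil I P u w = 0" if "bil I M w h = 0" for w
  proof (rule psd_kernel[OF symP _ uu])
    show "0 \<le> bil I P (\<lambda>s. u s + c * w s) (\<lambda>s. u s + c * w s)" for c
      by (rule psd) (simp add: bil_lin_left that uh)
  qed
  \<comment> \<open>Since \<open>h\<close> has eigenvalue 1, its \<open>D\<close>-product with
    \<open>u\<close> is the \<open>M\<close>-product, which is 0.\<close>
  have "(\<Sum>r\<in>I. D r * u r * h r) = bil I M u h"
    unfolding bil_def by (intro sum.cong) (auto simp: h)
  then have kerh: "bil I P u h = 0" by (simp add: bilP uh)
  have "mv I P u r = 0" if r: "r \<in> I" for r
  proof -
    define w where "w s = (if s = r then 1 else (0::real))" for s
    \<comment> \<open>Subtracting this multiple of \<open>h\<close> projects the unit vector into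
      the hyperplane.\<close>
    define c where "c = bil I M w h / bil I M h h"
    have "bil I M (\<lambda>s. w s + (- c) * h s) h = 0"
      unfolding bil_lin_left using hh by (simp add: c_def)
    then have "bil I P u (\<lambda>s. w s + (- c) * h s) = 0" by (rule ker)
    then have "bil I P u w = 0" unfolding bil_lin_right kerh by simp
    then show ?thesis
      using bil_unit[OF fin r, of P u] bil_commute[OF symP, of u w] unfolding w_def by simp
  qed
  then have "mv I M u r = e * D r * u r" if "r \<in> I" for r
    using mvP[OF that, of u] that by simp
  moreover have "\<exists>r\<in>I. u r \<noteq> 0" using nnu by (force simp: nn_def intro: ccontr)
  ultimately show ?thesis using \<open>e > 0\<close> uh by blast
qed

text \<open>For an eigenvector of \<open>D\<^sup>-\<^sup>1M\<close> with positive eigenvalue \<open>e\<close>, the inequality \<open>pull\<close> says \<open>e \<le> e\<^sup>2\<close>,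
  whereas the Perron argument with the positive eigenvector \<open>h\<close> says \<open>e \<le> 1\<close>, with equality only for
  multiples of \<open>h\<close>; the index \<open>z\<close> connects all others.\<close>

lemma atlas_hyperbolic:
  assumes fin: "finite I" and sym: "symmetric_matrix I M"
    and nonneg: "\<And>r s. r \<in> I \<Longrightarrow> s \<in> I \<Longrightarrow> M r s \<ge> 0"
    and hub: "z \<in> I" "\<And>s. s \<in> I \<Longrightarrow> M z s > 0"
    and h: "\<And>r. r \<in> I \<Longrightarrow> h r > 0"
    and pull: "\<And>v. bil I M v v \<le> (\<Sum>r\<in>I. h r * ((mv I M v r)\<^sup>2 / mv I M h r))"
  shows "hyperbolic I M"
proof (rule hyperbolicI[OF sym, of "\<lambda>f. bil I M f h"])
  show "bil I M (\<lambda>s. f s + c * g s) h = bil I M f h + c * bil I M g h" for f g c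
    by (rule bil_lin_left)
  have hub': "M s z > 0" if "s \<in> I" for s
    using hub that sym by (auto simp: symmetric_matrix_def)
  have mvh: "mv I M h r > 0" if "r \<in> I" for r
  proof -
    have "0 \<le> M r s * h s" if "s \<in> I" for s
      using nonneg[OF \<open>r \<in> I\<close> that] h[OF that] by simp
    moreover have "0 < M r z * h z" using hub'[OF that] h[OF hub(1)] by simp
    ultimately show ?thesis
      unfolding mv_def by (intro sum_pos2[OF fin hub(1)])
  qed
  have hh: "bil I M h h > 0"
    unfolding bil_def using hub(1) by (intro sum_pos fin) (auto intro!: mult_pos_pos h mvh)
  fix v assume v: "bil I M v h = 0"
  show "bil I M v v \<le> 0"
  proof (rule ccontr)
    assume "\<not> bil I M v v \<le> 0"
    then have vv: "bil I M v v > 0" by simp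
    \<comment> \<open>Chosen to give \<open>h\<close> eigenvalue 1.\<close>
    define D where "D r = mv I M h r / h r" for r
    have Dpos: "D r > 0" if "r \<in> I" for r using mvh h that by (simp add: D_def)
    have Dh: "mv I M h r = D r * h r" if "r \<in> I" for r using h[OF that] by (simp add: D_def)
    obtain u e where e: "e > 0" and eig: "\<And>r. r \<in> I \<Longrightarrow> mv I M u r = e * D r * u r"
      and uh: "bil I M u h = 0" and u: "\<exists>r\<in>I. u r \<noteq> 0"
      using exists_top_eigenvector[OF fin sym Dpos Dh hh v vv] by blast
    let ?n = "\<Sum>r\<in>I. D r * (u r)\<^sup>2"
    obtain r0 where r0: "r0 \<in> I" "u r0 \<noteq> 0" using u by auto
    have "0 \<le> D r * (u r)\<^sup>2" if "r \<in> I" for r using Dpos[OF that] by simp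
    then have "?n > 0"
      using Dpos[OF r0(1)] r0(2) by (intro sum_pos2[OF fin r0(1)]) auto
    have "bil I M u u = e * ?n"
      unfolding bil_def sum_distrib_left
      by (intro sum.cong) (auto simp: eig power2_eq_square)
    moreover have "(\<Sum>r\<in>I. h r * ((mv I M u r)\<^sup>2 / mv I M h r)) = e\<^sup>2 * ?n"
      unfolding sum_distrib_left
    proof (intro sum.cong refl)
      fix r assume r: "r \<in> I"
      show "h r * ((mv I M u r)\<^sup>2 / mv I M h r) = e\<^sup>2 * (D r * (u r)\<^sup>2)"
        using h[OF r] Dpos[OF r] unfolding eig[OF r] Dh[OF r]
        by (simp add: power2_eq_square field_simps)
    qed
    ultimately have "e * ?n \<le> e\<^sup>2 * ?n" using pull[of u] by simp
    then have "e \<le> e\<^sup>2" using \<open>?n > 0\<close> by simp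
    then have e1: "e \<ge> 1" using e by (simp add: power2_eq_square)
    \<comment> \<open>The least \<open>t\<close> with \<open>u <= t * h\<close> on \<open>I\<close>;
      equality holds at the index \<open>q\<close> found below.\<close>
    define t where "t = Max ((\<lambda>r. u r / h r) ` I)"
    have "t \<in> (\<lambda>r. u r / h r) ` I" unfolding t_def using fin hub by (intro Max_in) auto
    then obtain q where q: "q \<in> I" "t = u q / h q" by auto
    have ut: "u s \<le> t * h s" if "s \<in> I" for s
    proof -
      have "u s / h s \<le> t" unfolding t_def using fin that by (intro Max_ge) auto
      then show ?thesis using h[OF that] by (simp add: field_simps)
    qed
    have uq: "u q = t * h q" using q h[OF q(1)] by simp
    \<comment> \<open>Otherwise \<open>u\<close> is nonpositive and nonzero, and its pairing with
      the positive vector \<open>M h\<close> would be negative.\<close>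
    have "t > 0"
    proof (rule ccontr)
      assume t: "\<not> t > 0"
      have neg: "u s \<le> 0" if "s \<in> I" for s
        using ut[OF that] h[OF that] t by (smt (verit) mult_nonpos_nonneg)
      have "0 \<le> - u r * mv I M h r" if "r \<in> I" for r
        using neg[OF that] mvh[OF that] by (intro mult_nonneg_nonneg) auto
      moreover have "0 < - u r0 * mv I M h r0"
        using neg[OF r0(1)] r0(2) mvh[OF r0(1)] by (intro mult_pos_pos) auto
      ultimately have "0 < (\<Sum>r\<in>I. - u r * mv I M h r)"
        by (intro sum_pos2[OF fin r0(1)])
      moreover have "(\<Sum>r\<in>I. - u r * mv I M h r) = - bil I M u h"
        unfolding bil_def sum_negf[symmetric] by (intro sum.cong) auto
      ultimately show False using uh by linarith
    qed
    \<comment> \<open>Row \<open>r\<close> of \<open>M\<close> applied to the nonnegative vector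
      \<open>t * h - u\<close> gives \<open>(1 - e) * D r * t * h r\<close>, at most 0, so every
      term vanishes.\<close>
    have spread: "u s = t * h s" if r: "r \<in> I" "u r = t * h r" and s: "s \<in> I" "M r s > 0" for r s
    proof -
      have "(\<Sum>s\<in>I. M r s * (t * h s - u s)) = t * mv I M h r - mv I M u r"
        by (simp add: mv_def right_diff_distrib sum_subtractf sum_distrib_left mult_ac)
      also have "\<dots> = (1 - e) * (D r * (t * h r))"
        using r by (simp add: eig Dh algebra_simps)
      also have "\<dots> \<le> 0"
        using e1 Dpos[OF r(1)] h[OF r(1)] \<open>t > 0\<close> by (intro mult_nonpos_nonneg) auto
      finally have "(\<Sum>s\<in>I. M r s * (t * h s - u s)) = 0"
        by (intro antisym sum_nonneg) (auto intro!: mult_nonneg_nonneg nonneg r ut)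
      then have "\<forall>s\<in>I. M r s * (t * h s - u s) = 0"
        by (subst (asm) sum_nonneg_eq_0_iff) (auto intro!: mult_nonneg_nonneg nonneg r ut fin)
      then show ?thesis using s by auto
    qed
    \<comment> \<open>Equality travels from \<open>q\<close> to \<open>z\<close> and on to all
      indices, making \<open>u\<close> a positive multiple of \<open>h\<close>, against
      orthogonality.\<close>
    have uo: "u z = t * h z" by (rule spread[OF q(1) uq hub(1) hub'[OF q(1)]])
    have "u s = t * h s" if "s \<in> I" for s by (rule spread[OF hub(1) uo that hub(2)[OF that]])
    then have "bil I M u h = t * bil I M h h"
      unfolding bil_def sum_distrib_left by (intro sum.cong) auto
    then show False using uh hh \<open>t > 0\<close> by simp
  qed
qed

text \<open>Renaming the indices leaves the triple sum unchanged, so six copies of it add up to the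
  sum of the symmetrised terms.\<close>

lemma sum3_nonneg_by_symmetrization:
  fixes e :: "'a \<Rightarrow> 'a \<Rightarrow> 'a \<Rightarrow> real"
  assumes "\<And>x y z. x \<in> A \<Longrightarrow> y \<in> A \<Longrightarrow> z \<in> A \<Longrightarrow>
    0 \<le> e x y z + e x z y + e y x z + e y z x + e z x y + e z y x"
  shows "0 \<le> (\<Sum>x\<in>A. \<Sum>y\<in>A. \<Sum>z\<in>A. e x y z)" (is "0 \<le> ?s")
proof -
  have 1: "(\<Sum>x\<in>A. \<Sum>y\<in>A. \<Sum>z\<in>A. e x z y) = ?s"
    by (intro sum.cong refl sum.swap)
  have 2: "(\<Sum>x\<in>A. \<Sum>y\<in>A. \<Sum>z\<in>A. e y x z) = ?s"
    by (rule sum.swap)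
  have 3: "(\<Sum>x\<in>A. \<Sum>y\<in>A. \<Sum>z\<in>A. e z x y) = ?s"
    unfolding 2[symmetric] by (intro sum.cong refl sum.swap)
  have 4: "(\<Sum>x\<in>A. \<Sum>y\<in>A. \<Sum>z\<in>A. e y z x) = ?s"
    unfolding 1[symmetric] by (rule sum.swap)
  have 5: "(\<Sum>x\<in>A. \<Sum>y\<in>A. \<Sum>z\<in>A. e z y x) = ?s"
    unfolding 4[symmetric] by (intro sum.cong refl sum.swap)
  have "0 \<le> (\<Sum>x\<in>A. \<Sum>y\<in>A. \<Sum>z\<in>A. e x y z + e x z y + e y x z + e y z x + e z x y + e z y x)"
    by (intro sum_nonneg assms)
  also have "\<dots> = 6 * ?s"
    by (simp only: sum.distrib 1 2 3 4 5)
  finally show ?thesis by simp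
qed

subsection \<open>The matrices of a weighted poset\<close>

locale weighted_poset =
  fixes X :: "'a set" and lt :: "'a \<Rightarrow> 'a \<Rightarrow> bool" and \<omega> :: "'a \<Rightarrow> real"
  assumes finite_X: "finite X"
    and poset: "strict_poset X lt"
    and weight_pos: "\<And>x. x \<in> X \<Longrightarrow> \<omega> x > 0"
begin

lemma irrefl: "x \<in> X \<Longrightarrow> \<not> lt x x"
  using poset by (auto simp: strict_poset_def irreflp_on_def)

lemma trans: "\<lbrakk>x \<in> X; y \<in> X; z \<in> X; lt x y; lt y z\<rbrakk> \<Longrightarrow> lt x z"
  using poset unfolding strict_poset_def transp_on_def by blast

text \<open>These are the minimal elements of \<open>X - S\<close>.\<close>

definition cont :: "'a set \<Rightarrow> 'a set" where
  "cont S = {x \<in> X - S. \<forall>y\<in>X. lt y x \<longrightarrow> y \<in> S}"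

definition lower :: "'a set \<Rightarrow> bool" where
  "lower S \<longleftrightarrow> S \<subseteq> X \<and> (\<forall>x\<in>S. \<forall>y\<in>X. lt y x \<longrightarrow> y \<in> S)"

fun W :: "nat \<Rightarrow> 'a set \<Rightarrow> real" where
  "W 0 S = 1"
| "W (Suc m) S = (\<Sum>x\<in>cont S. \<omega> x * W m (insert x S))"

text \<open>The index set is \<open>cont S\<close> with an extra point \<open>None\<close> standing for no letter. A word \<open>xy\<close> whose second
  letter is available only after \<open>x\<close> is counted in the diagonal entry of \<open>x\<close>: this keeps the matrix
  symmetric and its row sums right. Accordingly \<open>lead S x y\<close> is the column of the word \<open>xy\<close> in row \<open>x\<close>.
  Off the index set the entries of \<open>mat\<close> are junk.\<close>

definition lead :: "'a set \<Rightarrow> 'a \<Rightarrow> 'a \<Rightarrow> 'a" where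
  "lead S x y = (if y \<in> cont S then y else x)"

definition idx :: "'a set \<Rightarrow> 'a option set" where
  "idx S = insert None (Some ` cont S)"

fun mat :: "('a set \<Rightarrow> real) \<Rightarrow> 'a set \<Rightarrow> 'a option \<Rightarrow> 'a option \<Rightarrow> real" where
  "mat F S None None = F S"
| "mat F S None (Some x) = \<omega> x * F (insert x S)"
| "mat F S (Some x) None = \<omega> x * F (insert x S)"
| "mat F S (Some x) (Some y) =
    (if x = y then \<omega> x * (\<Sum>z\<in>cont (insert x S) - cont S. \<omega> z * F (insert z (insert x S)))
     else \<omega> x * \<omega> y * F (insert y (insert x S)))"

lemma cont_subset: "cont S \<subseteq> X"
  by (auto simp: cont_def)

lemma finite_cont [simp]: "finite (cont S)"
  using cont_subset finite_X by (rule finite_subset)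

lemma finite_idx [simp]: "finite (idx S)"
  by (simp add: idx_def)

lemma mem_idx [simp]: "None \<in> idx S" "Some x \<in> idx S \<longleftrightarrow> x \<in> cont S"
  by (auto simp: idx_def)

lemma weight_cont: "x \<in> cont S \<Longrightarrow> \<omega> x > 0"
  using cont_subset weight_pos by blast

lemma lower_insert: "lower S \<Longrightarrow> x \<in> cont S \<Longrightarrow> lower (insert x S)"
  by (auto simp: lower_def cont_def)

lemma sum_idx: "(\<Sum>r\<in>idx S. g r) = g None + (\<Sum>x\<in>cont S. g (Some x))"
  by (simp add: idx_def sum.reindex)

lemma sum_cont_insert:
  assumes "x \<in> cont S"
  shows "(\<Sum>y\<in>cont (insert x S). g y) =
    (\<Sum>y\<in>cont S - {x}. g y) + (\<Sum>y\<in>cont (insert x S) - cont S. g y :: real)"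
proof -
  have "cont (insert x S) = (cont S - {x}) \<union> (cont (insert x S) - cont S)"
    by (auto simp: cont_def)
  then show ?thesis
    by (metis (no_types, lifting) Diff_disjoint Diff_subset finite_Diff finite_cont sum.union_disjoint
        Int_Diff Int_commute inf.absorb_iff2 Diff_Int_distrib2 Diff_empty empty_Diff Int_empty_right)
qed

lemma symmetric_mat: "symmetric_matrix (idx S) (mat F S)"
  by (auto simp: symmetric_matrix_def idx_def insert_commute mult_ac)

lemma mv_mat_None:
  "mv (idx S) (mat F S) v None = (\<Sum>x\<in>cont S. \<omega> x * F (insert x S) * v (Some x)) + F S * v None"
  by (simp add: mv_def sum_idx)

text \<open>The diagonal entry gathers the letters available only after \<open>x\<close>, and
  \<open>lead\<close> sends them to column \<open>x\<close>; the row becomes one sum over all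
  letters available after \<open>x\<close>.\<close>

lemma mv_mat_Some:
  assumes "x \<in> cont S"
  shows "mv (idx S) (mat F S) v (Some x) = \<omega> x *
    ((\<Sum>y\<in>cont (insert x S). \<omega> y * F (insert y (insert x S)) * v (Some (lead S x y)))
      + F (insert x S) * v None)"
proof -
  let ?d = "\<Sum>z\<in>cont (insert x S) - cont S. \<omega> z * F (insert z (insert x S))"
  have "(\<Sum>y\<in>cont S - {x}. mat F S (Some x) (Some y) * v (Some y))
      = (\<Sum>y\<in>cont S - {x}. \<omega> x * \<omega> y * F (insert y (insert x S)) * v (Some y))"
    by (intro sum.cong) auto
  then have "(\<Sum>y\<in>cont S. mat F S (Some x) (Some y) * v (Some y)) =
      \<omega> x * ?d * v (Some x) + (\<Sum>y\<in>cont S - {x}. \<omega> x * \<omega> y * F (insert y (insert x S)) * v (Some y))"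
    using assms by (subst sum.remove[of _ x]) simp_all
  also have "(\<Sum>y\<in>cont S - {x}. \<omega> x * \<omega> y * F (insert y (insert x S)) * v (Some y))
      = \<omega> x * (\<Sum>y\<in>cont S - {x}. \<omega> y * F (insert y (insert x S)) * v (Some (lead S x y)))"
    unfolding sum_distrib_left by (intro sum.cong) (auto simp: lead_def)
  also have "?d * v (Some x) = (\<Sum>y\<in>cont (insert x S) - cont S.
      \<omega> y * F (insert y (insert x S)) * v (Some (lead S x y)))"
    unfolding sum_distrib_right by (intro sum.cong) (auto simp: lead_def)
  then have "\<omega> x * ?d * v (Some x) = \<omega> x * (\<Sum>y\<in>cont (insert x S) - cont S.
      \<omega> y * F (insert y (insert x S)) * v (Some (lead S x y)))" by simp
  finally show ?thesis
    using sum_cont_insert[OF assms, of "\<lambda>y. \<omega> y * F (insert y (insert x S)) * v (Some (lead S x y))"]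
    by (simp add: mv_def sum_idx algebra_simps)
qed

lemma bil_mat:
  "bil (idx S) (mat F S) u v =
    (\<Sum>x\<in>cont S. u (Some x) * (\<omega> x *
      ((\<Sum>y\<in>cont (insert x S). \<omega> y * F (insert y (insert x S)) * v (Some (lead S x y)))
        + F (insert x S) * v None)))
    + u None * ((\<Sum>x\<in>cont S. \<omega> x * F (insert x S) * v (Some x)) + F S * v None)"
  by (simp add: bil_def sum_idx mv_mat_None mv_mat_Some)

lemma mat_lin:
  "mat (\<lambda>S. a * F S + b * G S) S = (\<lambda>r s. a * mat F S r s + b * mat G S r s)"
proof (intro ext)
  fix r s show "mat (\<lambda>S. a * F S + b * G S) S r s = a * mat F S r s + b * mat G S r s"
    by (cases r; cases s) (auto simp: algebra_simps sum.distrib sum_distrib_left)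
qed

subsection \<open>Positivity\<close>

lemma W_nonneg: "W m S \<ge> 0"
  by (induction m arbitrary: S) (auto intro!: sum_nonneg mult_nonneg_nonneg less_imp_le[OF weight_cont])

lemma cont_nonempty:
  assumes "S \<subset> X"
  shows "cont S \<noteq> {}"
proof -
  have "finite (X - S)" "X - S \<noteq> {}" using assms finite_X by auto
  moreover have "transp_on (X - S) lt"
    using trans by (intro transp_onI) blast
  moreover have "asymp_on (X - S) lt"
    using trans irrefl by (intro asymp_onI) blast
  ultimately obtain x where x: "x \<in> X - S" "\<forall>y\<in>X - S. y \<noteq> x \<longrightarrow> \<not> lt y x"
    by (metis Finite_Set.bex_min_element)
  have "y \<in> S" if "y \<in> X" "lt y x" for y
    using that x irrefl by (metis DiffD1 DiffI)
  then have "x \<in> cont S" using x(1) by (simp add: cont_def)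
  then show ?thesis by auto
qed

text \<open>While letters remain, \<open>X - S\<close> has a minimal element, so a continuation
  always exists.\<close>

lemma W_pos: "lower S \<Longrightarrow> card S + m \<le> card X \<Longrightarrow> W m S > 0"
proof (induction m arbitrary: S)
  case (Suc m)
  have "S \<subset> X" using Suc.prems by (auto simp: lower_def)
  then have ne: "cont S \<noteq> {}" by (rule cont_nonempty)
  have "W m (insert x S) > 0" if "x \<in> cont S" for x
  proof (rule Suc.IH)
    show "lower (insert x S)" using Suc.prems that by (intro lower_insert)
    have "finite S" "x \<notin> S" using \<open>S \<subset> X\<close> finite_X that by (auto simp: cont_def intro: finite_subset)
    then show "card (insert x S) + m \<le> card X" using Suc.prems by simp
  qed
  then show ?case using ne by (auto intro!: sum_pos mult_pos_pos weight_cont)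
qed simp

subsection \<open>Three-letter extensions\<close>

text \<open>The part of availability shared by the tests in \<open>mem_cont_iff\<close>; the rest
  depends only on the order among the three letters, which leaves a finite case check.\<close>

definition below_in :: "'a set \<Rightarrow> 'a \<Rightarrow> 'a \<Rightarrow> 'a \<Rightarrow> bool" where
  "below_in S x y z \<longleftrightarrow> (\<forall>t\<in>X. lt t x \<longrightarrow> t \<in> S \<or> t = y \<or> t = z)"

lemma below_in_commute: "below_in S x y z = below_in S x z y"
  by (auto simp: below_in_def)

lemma mem_cont_iff:
  assumes "x \<in> X - S" "y \<in> X - S" "z \<in> X - S" "x \<noteq> y" "x \<noteq> z" "y \<noteq> z"
  shows "x \<in> cont S \<longleftrightarrow> below_in S x y z \<and> \<not> lt y x \<and> \<not> lt z x"
    and "x \<in> cont (insert y S) \<longleftrightarrow> below_in S x y z \<and> \<not> lt z x"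
    and "x \<in> cont (insert z (insert y S)) \<longleftrightarrow> below_in S x y z"
  using assms irrefl by (auto simp: cont_def below_in_def)

text \<open>The summand of \<open>triple_pull\<close>, right side minus left, without the common
  weight.\<close>

definition pull_term :: "'a set \<Rightarrow> ('a \<Rightarrow> real) \<Rightarrow> 'a \<Rightarrow> 'a \<Rightarrow> 'a \<Rightarrow> real" where
  "pull_term S a x y z =
    (if x \<in> cont S \<and> y \<in> cont (insert x S) \<and> z \<in> cont (insert y (insert x S))
     then a (lead S x y) * a (lead S x (lead (insert x S) y z)) - a x * a (lead S x y) else 0)"

text \<open>For each of the posets on three letters the six terms cancel, except when one letter lies above two
  incomparable ones \<open>p\<close>, \<open>q\<close>; then they add up to \<open>(a p - a q)\<^sup>2\<close>.\<close>

lemma pull_term_symmetrized: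
  assumes xyz: "x \<in> X" "y \<in> X" "z \<in> X"
  shows "0 \<le> pull_term S a x y z + pull_term S a x z y + pull_term S a y x z
    + pull_term S a y z x + pull_term S a z x y + pull_term S a z y x"
proof (cases "x \<in> S \<or> y \<in> S \<or> z \<in> S \<or> x = y \<or> x = z \<or> y = z")
  case True
  have "pull_term S a p q r = 0" if "p \<in> S \<or> q \<in> S \<or> r \<in> S \<or> p = q \<or> p = r \<or> q = r" for p q r
    using that unfolding pull_term_def by (intro if_not_P) (auto simp: cont_def)
  then show ?thesis using True by (smt (verit))
next
  case False
  define Bx where "Bx = below_in S x y z"
  define By where "By = below_in S y x z"
  define Bz where "Bz = below_in S z x y"
  have b: "below_in S x z y = Bx" "below_in S y z x = By" "below_in S z y x = Bz"
    by (auto simp: Bx_def By_def Bz_def below_in_commute)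
  have n: "x \<in> X - S" "y \<in> X - S" "z \<in> X - S" "x \<noteq> y" "x \<noteq> z" "y \<noteq> z"
    "y \<noteq> x" "z \<noteq> x" "z \<noteq> y"
    using xyz False by auto
  note m = mem_cont_iff[OF n(1,2,3,4,5,6), folded Bx_def]
    mem_cont_iff[OF n(1,3,2,5,4,9), unfolded b]
    mem_cont_iff[OF n(2,1,3,7,6,5), folded By_def]
    mem_cont_iff[OF n(2,3,1,6,7,8), unfolded b]
    mem_cont_iff[OF n(3,1,2,8,9,4), folded Bz_def]
    mem_cont_iff[OF n(3,2,1,9,8,7), unfolded b]
  have c:
    "x \<in> cont S \<longleftrightarrow> Bx \<and> \<not> lt y x \<and> \<not> lt z x"
    "y \<in> cont S \<longleftrightarrow> By \<and> \<not> lt x y \<and> \<not> lt z y"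
    "z \<in> cont S \<longleftrightarrow> Bz \<and> \<not> lt x z \<and> \<not> lt y z"
    "x \<in> cont (insert y S) \<longleftrightarrow> Bx \<and> \<not> lt z x"
    "x \<in> cont (insert z S) \<longleftrightarrow> Bx \<and> \<not> lt y x"
    "y \<in> cont (insert x S) \<longleftrightarrow> By \<and> \<not> lt z y"
    "y \<in> cont (insert z S) \<longleftrightarrow> By \<and> \<not> lt x y"
    "z \<in> cont (insert x S) \<longleftrightarrow> Bz \<and> \<not> lt y z"
    "z \<in> cont (insert y S) \<longleftrightarrow> Bz \<and> \<not> lt x z"
    "x \<in> cont (insert y (insert z S)) \<longleftrightarrow> Bx"
    "x \<in> cont (insert z (insert y S)) \<longleftrightarrow> Bx"
    "y \<in> cont (insert x (insert z S)) \<longleftrightarrow> By"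
    "y \<in> cont (insert z (insert x S)) \<longleftrightarrow> By"
    "z \<in> cont (insert x (insert y S)) \<longleftrightarrow> Bz"
    "z \<in> cont (insert y (insert x S)) \<longleftrightarrow> Bz"
    by (simp_all only: m)
  have sq: "0 \<le> p * p - 2 * (p * q) + q * q" for p q :: real
    using zero_le_power2[of "p - q"] by (simp add: power2_eq_square algebra_simps)
  show ?thesis
  proof (cases "Bx \<and> By \<and> Bz")
    case False
    then consider "\<not> Bx" | "\<not> By" | "\<not> Bz" by auto
    then show ?thesis by cases (simp_all add: pull_term_def c)
  next
    case True
    \<comment> \<open>Asymmetry and transitivity leave only genuine posets among the 64 truth
      patterns below.\<close>
    have o: "lt x y \<Longrightarrow> \<not> lt y x" "lt x z \<Longrightarrow> \<not> lt z x" "lt y z \<Longrightarrow> \<not> lt z y"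
      "lt x y \<Longrightarrow> lt y z \<Longrightarrow> lt x z" "lt x z \<Longrightarrow> lt z y \<Longrightarrow> lt x y"
      "lt y x \<Longrightarrow> lt x z \<Longrightarrow> lt y z" "lt y z \<Longrightarrow> lt z x \<Longrightarrow> lt y x"
      "lt z x \<Longrightarrow> lt x y \<Longrightarrow> lt z y" "lt z y \<Longrightarrow> lt y x \<Longrightarrow> lt z x"
      using trans irrefl xyz by blast+
    show ?thesis
      using True o sq[of "a x" "a y"] sq[of "a x" "a z"] sq[of "a y" "a z"]
      by (cases "lt x y"; cases "lt y x"; cases "lt x z"; cases "lt z x"; cases "lt y z"; cases "lt z y")
        (simp_all add: pull_term_def lead_def c algebra_simps)
  qed
qed

lemma sum_cont: "(\<Sum>x\<in>cont S. g x) = (\<Sum>x\<in>X. if x \<in> cont S then g x else (0::real))"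
  using cont_subset finite_X by (intro sum.mono_neutral_cong_left) auto

lemma sum_cont3:
  "(\<Sum>x\<in>cont S. \<Sum>y\<in>cont (insert x S). \<Sum>z\<in>cont (insert y (insert x S)). g x y z) =
    (\<Sum>x\<in>X. \<Sum>y\<in>X. \<Sum>z\<in>X.
      if x \<in> cont S \<and> y \<in> cont (insert x S) \<and> z \<in> cont (insert y (insert x S)) then g x y z else (0::real))"
  unfolding sum_cont by (auto intro!: sum.cong)

text \<open>The weight factor depends only on the set of the three letters, so the difference may be
  symmetrised over their orders.\<close>

lemma triple_pull:
  assumes F: "\<And>S. F S \<ge> 0"
  shows "(\<Sum>x\<in>cont S. \<Sum>y\<in>cont (insert x S). \<Sum>z\<in>cont (insert y (insert x S)).
      \<omega> x * \<omega> y * \<omega> z * F (insert z (insert y (insert x S))) * (a x * a (lead S x y)))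
    \<le> (\<Sum>x\<in>cont S. \<Sum>y\<in>cont (insert x S). \<Sum>z\<in>cont (insert y (insert x S)).
      \<omega> x * \<omega> y * \<omega> z * F (insert z (insert y (insert x S)))
        * (a (lead S x y) * a (lead S x (lead (insert x S) y z))))" (is "?L \<le> ?R")
proof -
  let ?k = "\<lambda>x y z. \<omega> x * \<omega> y * \<omega> z * F (insert z (insert y (insert x S)))"
  have "?R - ?L = (\<Sum>x\<in>X. \<Sum>y\<in>X. \<Sum>z\<in>X. ?k x y z * pull_term S a x y z)"
    unfolding sum_cont3 sum_subtractf[symmetric]
    by (intro sum.cong refl) (simp add: pull_term_def right_diff_distrib)
  also have "\<dots> \<ge> 0"
  proof (rule sum3_nonneg_by_symmetrization)
    fix x y z assume xyz: "x \<in> X" "y \<in> X" "z \<in> X"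
    let ?p = "pull_term S a"
    have k: "?k x z y = ?k x y z" "?k y x z = ?k x y z" "?k y z x = ?k x y z"
      "?k z x y = ?k x y z" "?k z y x = ?k x y z"
      by (simp_all add: insert_commute mult_ac)
    have "0 \<le> ?k x y z" using xyz F by (simp add: weight_pos less_imp_le)
    then have "0 \<le> ?k x y z * (?p x y z + ?p x z y + ?p y x z + ?p y z x + ?p z x y + ?p z y x)"
      using pull_term_symmetrized[OF xyz, of S a] by (rule mult_nonneg_nonneg)
    then show "0 \<le> ?k x y z * ?p x y z + ?k x z y * ?p x z y + ?k y x z * ?p y x z
       + ?k y z x * ?p y z x + ?k z x y * ?p z x y + ?k z y x * ?p z y x"
      unfolding k by (simp only: distrib_left)
  qed
  finally show ?thesis by simp
qed

section \<open>Comparison of consecutive levels\<close>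

definition shift :: "'a set \<Rightarrow> 'a \<Rightarrow> ('a option \<Rightarrow> real) \<Rightarrow> 'a option \<Rightarrow> real" where
  "shift S x v r = (case r of None \<Rightarrow> v None | Some y \<Rightarrow> v (Some (lead S x y)))"

lemma shift_simps [simp]: "shift S x v None = v None" "shift S x v (Some y) = v (Some (lead S x y))"
  by (simp_all add: shift_def)

definition extend :: "('a set \<Rightarrow> real) \<Rightarrow> 'a set \<Rightarrow> real" where
  "extend F S = (\<Sum>x\<in>cont S. \<omega> x * F (insert x S))"

text \<open>\<open>shift\<close> reads a vector for \<open>S\<close> as one for
  \<open>insert x S\<close>, giving a letter freed by \<open>x\<close> the value at
  \<open>x\<close>. After expansion the terms involving \<open>None\<close> agree, and those on
  letters alone are compared by \<open>triple_pull\<close>.\<close>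

lemma bil_mat_extend_le:
  assumes F: "\<And>S. F S \<ge> 0"
  shows "bil (idx S) (mat (extend F) S) v v \<le>
    (\<Sum>x\<in>cont S. \<omega> x * bil (idx (insert x S)) (mat F (insert x S)) (shift S x v) (shift S x v))"
proof -
  define a where "a x = v (Some x)" for x
  define c where "c = v None"
  let ?F2 = "\<lambda>x y. F (insert y (insert x S))"
  let ?F3 = "\<lambda>x y z. F (insert z (insert y (insert x S)))"
  define B where "B = (\<Sum>x\<in>cont S. \<Sum>y\<in>cont (insert x S). \<omega> x * \<omega> y * ?F2 x y * a (lead S x y))"
  define B' where "B' = (\<Sum>x\<in>cont S. \<Sum>y\<in>cont (insert x S). \<omega> x * \<omega> y * ?F2 x y * a x)"
  define A where "A = (\<Sum>x\<in>cont S. \<Sum>y\<in>cont (insert x S). \<Sum>z\<in>cont (insert y (insert x S)).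
      \<omega> x * \<omega> y * \<omega> z * ?F3 x y z * (a (lead S x y) * a (lead S x (lead (insert x S) y z))))"
  define A' where "A' = (\<Sum>x\<in>cont S. \<Sum>y\<in>cont (insert x S). \<Sum>z\<in>cont (insert y (insert x S)).
      \<omega> x * \<omega> y * \<omega> z * ?F3 x y z * (a x * a (lead S x y)))"
  have "bil (idx S) (mat (extend F) S) v v = A' + c * B' + c * B' + c * c * extend F S"
    unfolding bil_mat A'_def B'_def extend_def a_def[symmetric] c_def[symmetric]
    by (simp add: algebra_simps sum.distrib sum_distrib_left sum_distrib_right)
  moreover have "(\<Sum>x\<in>cont S. \<omega> x * bil (idx (insert x S)) (mat F (insert x S)) (shift S x v) (shift S x v))
      = A + c * B + c * B + c * c * extend F S"
    unfolding bil_mat A_def B_def extend_def shift_simps a_def[symmetric] c_def[symmetric]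
    by (simp add: algebra_simps sum.distrib sum_distrib_left sum_distrib_right)
  \<comment> \<open>Symmetry of the matrix of \<open>F\<close>, tested against the indicator of the
    letters.\<close>
  moreover have "B = B'"
  proof -
    define p where "p r = (case r of None \<Rightarrow> 0 | Some x \<Rightarrow> a x)" for r
    define q :: "'a option \<Rightarrow> real" where "q r = (case r of None \<Rightarrow> 0 | Some x \<Rightarrow> 1)" for r
    have "bil (idx S) (mat F S) q p = B"
      unfolding bil_mat B_def p_def q_def by (simp add: sum_distrib_left mult_ac)
    moreover have "bil (idx S) (mat F S) p q = B'"
      unfolding bil_mat B'_def p_def q_def by (simp add: sum_distrib_left mult_ac)
    ultimately show ?thesis using bil_commute[OF symmetric_mat] by metis
  qed
  moreover have "A' \<le> A"
    unfolding A_def A'_def by (rule triple_pull[OF F])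
  ultimately show ?thesis by simp
qed

subsection \<open>Hyperbolicity\<close>

lemma extend_W: "extend (W m) = W (Suc m)"
  by (simp add: extend_def fun_eq_iff)

text \<open>The matrix of level \<open>Suc m\<close> would need the vector that is 1 on letters and 0 at \<open>None\<close>, which is not
  positive. So it is mixed with the matrix of level \<open>m\<close>, and \<open>t\<close> tends to 1 at the end.\<close>

lemma hyperbolic_W_Suc:
  assumes S: "lower S" and m: "Suc m + card S \<le> card X"
    and hyp: "hyperbolic (idx S) (mat (W m) S)"
    and hyp_insert: "\<And>x. x \<in> cont S \<Longrightarrow> hyperbolic (idx (insert x S)) (mat (W m) (insert x S))"
  shows "hyperbolic (idx S) (mat (W (Suc m)) S)"
proof -
  let ?N = "\<lambda>t. mat (\<lambda>S. t * W (Suc m) S + (1 - t) * W m S) S"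
  have interp: "hyperbolic (idx S) (?N t)" if t: "0 < t" "t < 1" for t
  proof (rule atlas_hyperbolic[of _ _ None "\<lambda>r. case r of None \<Rightarrow> 1 - t | Some _ \<Rightarrow> t"])
    define h :: "'a option \<Rightarrow> real" where "h r = (case r of None \<Rightarrow> 1 - t | Some x \<Rightarrow> t)" for r
    have h [simp]: "h None = 1 - t" "h (Some x) = t" for x by (simp_all add: h_def)
    have shift_h: "shift S x h = h" for x
    proof
      show "shift S x h r = h r" for r by (cases r) simp_all
    qed
    let ?F = "\<lambda>S. t * W (Suc m) S + (1 - t) * W m S"
    have pos: "?F T > 0" if "lower T" "card T + m \<le> card X" for T
      using W_pos[OF that] W_nonneg[of "Suc m" T] t by (simp add: add_nonneg_pos)
    have F0: "?F T \<ge> 0" for T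
      using W_nonneg[of "Suc m" T] W_nonneg[of m T] t by (simp del: W.simps)
    have pos_insert: "?F (insert x S) > 0" if "x \<in> cont S" for x
    proof (rule pos)
      show "lower (insert x S)" using S that by (rule lower_insert)
      show "card (insert x S) + m \<le> card X"
        using m that finite_X S by (auto simp: cont_def lower_def card_insert_if finite_subset)
    qed
    show "finite (idx S)" "symmetric_matrix (idx S) (?N t)" "None \<in> idx S"
      by (simp_all add: symmetric_mat)
    show "?N t None s > 0" if "s \<in> idx S" for s
      using that pos[OF S] m pos_insert weight_cont by (auto simp: idx_def)
    show "?N t r s \<ge> 0" if "r \<in> idx S" "s \<in> idx S" for r s
      using that F0 by (cases r; cases s)
        (auto simp: idx_def simp del: W.simps intro!: mult_nonneg_nonneg sum_nonneg less_imp_le[OF weight_cont])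
    show "(case r of None \<Rightarrow> 1 - t | Some _ \<Rightarrow> t) > 0" for r :: "'a option"
      using t by (cases r) auto
    \<comment> \<open>Level \<open>m\<close> applied to \<open>h\<close> produces exactly the mixed
      function \<open>?F\<close>. Hence each row of \<open>?N t\<close> is a level \<open>m\<close>
      pairing with \<open>h\<close>: at \<open>S\<close> for \<open>None\<close>, at
      \<open>insert x S\<close> (times \<open>\<omega> x\<close>) for \<open>x\<close>.\<close>
    have mvh: "mv (idx T) (mat (W m) T) h r = (case r of None \<Rightarrow> ?F T | Some x \<Rightarrow> \<omega> x * ?F (insert x T))"
      if "r \<in> idx T" for r T
      using that by (cases r) (auto simp: mv_mat_None mv_mat_Some sum_distrib_left sum_distrib_right algebra_simps)
    have inh_None: "mv (idx S) (?N t) v None = bil (idx S) (mat (W m) S) v h" for v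
      by (simp add: bil_def sum_idx mvh mv_mat_None mult_ac del: W.simps)
    have inh_Some: "mv (idx S) (?N t) v (Some x) =
        \<omega> x * bil (idx (insert x S)) (mat (W m) (insert x S)) (shift S x v) h" if "x \<in> cont S" for v x
      using that by (simp add: bil_def sum_idx mvh mv_mat_Some mult_ac del: W.simps)
    have hh: "bil (idx T) (mat (W m) T) h h > 0" if "?F T > 0" for T
    proof -
      have "bil (idx T) (mat (W m) T) h h = (1 - t) * ?F T + (\<Sum>x\<in>cont T. t * (\<omega> x * ?F (insert x T)))"
        by (simp add: bil_def sum_idx mvh del: W.simps)
      moreover have "0 \<le> (\<Sum>x\<in>cont T. t * (\<omega> x * ?F (insert x T)))"
        using t F0 by (intro sum_nonneg mult_nonneg_nonneg less_imp_le[OF weight_cont]) auto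
      moreover have "0 < (1 - t) * ?F T" using t that by simp
      ultimately show ?thesis by linarith
    qed
    fix v
    let ?v = "\<lambda>x. shift S x v"
    let ?q = "\<lambda>x. bil (idx (insert x S)) (mat (W m) (insert x S))"
    have q_None: "bil (idx S) (mat (W m) S) v v \<le> (mv (idx S) (?N t) v None)\<^sup>2 / mv (idx S) (?N t) h None"
    proof -
      have "bil (idx S) (mat (W m) S) h h > 0" using hh pos[OF S] m by simp
      then show ?thesis using hyp unfolding inh_None hyperbolic_def by (simp add: pos_le_divide_eq)
    qed
    have q_Some: "\<omega> x * ?q x (?v x) (?v x) \<le> (mv (idx S) (?N t) v (Some x))\<^sup>2 / mv (idx S) (?N t) h (Some x)"
      if x: "x \<in> cont S" for x
    proof -
      have p: "?q x h h > 0" by (rule hh[OF pos_insert[OF x]])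
      then have "?q x (?v x) (?v x) \<le> (?q x (?v x) h)\<^sup>2 / ?q x h h"
        using hyp_insert[OF x] unfolding hyperbolic_def by (simp add: pos_le_divide_eq)
      then have "\<omega> x * ?q x (?v x) (?v x) \<le> \<omega> x * ((?q x (?v x) h)\<^sup>2 / ?q x h h)"
        using weight_cont[OF x] by (intro mult_left_mono) auto
      also have "\<dots> = (mv (idx S) (?N t) v (Some x))\<^sup>2 / mv (idx S) (?N t) h (Some x)"
        unfolding inh_Some[OF x] shift_h using weight_cont[OF x] by (simp add: power2_eq_square)
      finally show ?thesis .
    qed
    \<comment> \<open>The mixture has the weights of \<open>h\<close>: the level
      \<open>Suc m\<close> part is bounded through the sets \<open>insert x S\<close>, the level
      \<open>m\<close> part by hyperbolicity at \<open>S\<close>.\<close>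
    have "bil (idx S) (?N t) v v = t * bil (idx S) (mat (extend (W m)) S) v v + (1 - t) * bil (idx S) (mat (W m) S) v v"
      unfolding mat_lin bil_matrix_lin extend_W ..
    also have "\<dots> \<le> t * (\<Sum>x\<in>cont S. \<omega> x * ?q x (?v x) (?v x)) + (1 - t) * bil (idx S) (mat (W m) S) v v"
      using t bil_mat_extend_le[of "W m" S v] W_nonneg by simp
    also have "\<dots> \<le> t * (\<Sum>x\<in>cont S. (mv (idx S) (?N t) v (Some x))\<^sup>2 / mv (idx S) (?N t) h (Some x))
        + (1 - t) * ((mv (idx S) (?N t) v None)\<^sup>2 / mv (idx S) (?N t) h None)"
      using t by (intro add_mono mult_left_mono sum_mono q_Some q_None) auto
    also have "\<dots> = (\<Sum>r\<in>idx S. h r * ((mv (idx S) (?N t) v r)\<^sup>2 / mv (idx S) (?N t) h r))"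
      by (simp only: sum_idx h sum_distrib_left add.commute)
    finally show "bil (idx S) (?N t) v v \<le> (\<Sum>r\<in>idx S. (case r of None \<Rightarrow> 1 - t | Some _ \<Rightarrow> t) *
        ((mv (idx S) (?N t) v r)\<^sup>2 / mv (idx S) (?N t) (\<lambda>r. case r of None \<Rightarrow> 1 - t | Some _ \<Rightarrow> t) r))"
      unfolding h_def .
  qed
  show ?thesis
    unfolding hyperbolic_def
  proof (intro allI impI)
    fix f g
    let ?M = "mat (W (Suc m)) S"
    assume g: "bil (idx S) ?M g g > 0"
    have lim: "((\<lambda>t. bil (idx S) (?N t) u v) \<longlongrightarrow> bil (idx S) ?M u v) (at_left 1)" for u v
      unfolding mat_lin bil_matrix_lin by (auto intro!: tendsto_eq_intros)
    have "\<forall>\<^sub>F t in at_left 1. 0 < bil (idx S) (?N t) g g"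
      using lim g by (rule order_tendstoD)
    moreover have "\<forall>\<^sub>F t in at_left 1. 0 < t \<and> t < (1::real)"
      unfolding eventually_at_left_field by (rule exI[of _ 0]) auto
    ultimately have "\<forall>\<^sub>F t in at_left 1. bil (idx S) (?N t) f f * bil (idx S) (?N t) g g \<le> (bil (idx S) (?N t) f g)\<^sup>2"
      by eventually_elim (use interp in \<open>auto simp: hyperbolic_def\<close>)
    then show "bil (idx S) ?M f f * bil (idx S) ?M g g \<le> (bil (idx S) ?M f g)\<^sup>2"
      by (intro tendsto_le[OF _ tendsto_power[OF lim] tendsto_mult[OF lim lim]]) auto
  qed
qed

text \<open>The matrix is a rank one matrix minus a diagonal one, and the weight condition makes the diagonal
  entries nonnegative.\<close>

lemma hyperbolic_W_0:
  assumes S: "lower S"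
    and cov: "\<And>x. x \<in> X \<Longrightarrow> (\<Sum>y\<in>Cov X lt x. \<omega> y) \<le> \<omega> x"
  shows "hyperbolic (idx S) (mat (W 0) S)"
proof (rule hyperbolicI[OF symmetric_mat])
  \<comment> \<open>With \<open>W 0\<close> constantly 1, the rank one part of the form is the
    square of \<open>l\<close>, so only the diagonal part survives on
    \<open>l v = 0\<close>.\<close>
  define l where "l v = v None + (\<Sum>x\<in>cont S. \<omega> x * v (Some x))" for v :: "'a option \<Rightarrow> real"
  show "l (\<lambda>s. f s + c * g s) = l f + c * l g" for f g c
    by (simp add: l_def algebra_simps sum.distrib sum_distrib_left)
  fix v assume v: "l v = 0"
  let ?D = "\<lambda>x. \<Sum>y\<in>cont (insert x S) - cont S. \<omega> y"
  have D: "?D x \<le> \<omega> x" if x: "x \<in> cont S" for x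
  proof -
    \<comment> \<open>A letter freed by \<open>x\<close> lies above \<open>x\<close>; any letter
      strictly between would lie in the lower set \<open>S\<close>, forcing \<open>x\<close> into
      \<open>S\<close>.\<close>
    have "cont (insert x S) - cont S \<subseteq> Cov X lt x"
      using x S by (auto simp: cont_def lower_def Cov_def)
    moreover have "finite (Cov X lt x)"
      using finite_X by (simp add: Cov_def)
    ultimately have "?D x \<le> (\<Sum>y\<in>Cov X lt x. \<omega> y)"
      by (intro sum_mono2) (auto simp: Cov_def intro: less_imp_le[OF weight_pos])
    also have "\<dots> \<le> \<omega> x" using cov x cont_subset by blast
    finally show ?thesis .
  qed
  have row: "mv (idx S) (mat (W 0) S) v (Some x) = \<omega> x * (?D x - \<omega> x) * v (Some x)"
    if x: "x \<in> cont S" for x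
  proof -
    have "(\<Sum>y\<in>cont (insert x S). \<omega> y * v (Some (lead S x y)))
        = (\<Sum>y\<in>cont S - {x}. \<omega> y * v (Some y)) + ?D x * v (Some x)"
      unfolding sum_cont_insert[OF x] sum_distrib_right
      by (intro arg_cong2[of _ _ _ _ "(+)"] sum.cong) (auto simp: lead_def)
    also have "(\<Sum>y\<in>cont S - {x}. \<omega> y * v (Some y)) = - v None - \<omega> x * v (Some x)"
      using v x by (simp add: l_def sum.remove[of _ x])
    finally have "(\<Sum>y\<in>cont (insert x S). \<omega> y * v (Some (lead S x y))) + v None = (?D x - \<omega> x) * v (Some x)"
      by (simp add: algebra_simps)
    then show ?thesis by (simp add: mv_mat_Some[OF x] mult.assoc)
  qed
  have "mv (idx S) (mat (W 0) S) v None = 0"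
    using v by (simp add: mv_mat_None l_def)
  then have "bil (idx S) (mat (W 0) S) v v = (\<Sum>x\<in>cont S. - (\<omega> x * (\<omega> x - ?D x) * (v (Some x))\<^sup>2))"
    by (simp add: bil_def sum_idx row power2_eq_square algebra_simps)
  also have "\<dots> \<le> 0"
    using D weight_cont by (intro sum_nonpos) (simp add: less_imp_le)
  finally show "bil (idx S) (mat (W 0) S) v v \<le> 0" .
qed

lemma hyperbolic_W:
  assumes cov: "\<And>x. x \<in> X \<Longrightarrow> (\<Sum>y\<in>Cov X lt x. \<omega> y) \<le> \<omega> x"
  shows "lower S \<Longrightarrow> m + card S \<le> card X \<Longrightarrow> hyperbolic (idx S) (mat (W m) S)"
proof (induction m arbitrary: S)
  case 0
  then show ?case by (intro hyperbolic_W_0 cov)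
next
  case (Suc m)
  show ?case
  proof (rule hyperbolic_W_Suc[OF Suc.prems])
    show "hyperbolic (idx S) (mat (W m) S)" using Suc by simp
    fix x assume x: "x \<in> cont S"
    show "hyperbolic (idx (insert x S)) (mat (W m) (insert x S))"
    proof (rule Suc.IH)
      show "lower (insert x S)" using Suc.prems(1) x by (rule lower_insert)
      show "m + card (insert x S) \<le> card X"
        using Suc.prems x finite_X by (auto simp: cont_def lower_def card_insert_if finite_subset)
    qed
  qed
qed

lemma W_log_concave:
  assumes cov: "\<And>x. x \<in> X \<Longrightarrow> (\<Sum>y\<in>Cov X lt x. \<omega> y) \<le> \<omega> x"
    and S: "lower S" "m + card S \<le> card X"
  shows "W m S * W (Suc (Suc m)) S \<le> (W (Suc m) S)\<^sup>2"
proof -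
  \<comment> \<open>Diagonal and off-diagonal letter entries together count each two-letter
    continuation once, so \<open>f\<close> paired with itself gives
    \<open>W (Suc (Suc m)) S\<close>.\<close>
  define f :: "'a option \<Rightarrow> real" where "f r = (case r of None \<Rightarrow> 0 | Some x \<Rightarrow> 1)" for r
  define g :: "'a option \<Rightarrow> real" where "g r = (case r of None \<Rightarrow> 1 | Some x \<Rightarrow> 0)" for r
  have "bil (idx S) (mat (W m) S) g g = W m S"
    "bil (idx S) (mat (W m) S) f g = W (Suc m) S"
    "bil (idx S) (mat (W m) S) f f = W (Suc (Suc m)) S"
    by (simp_all add: bil_mat f_def g_def)
  moreover have "W m S > 0" using S by (intro W_pos) auto
  ultimately show ?thesis
    using hyperbolic_W[OF cov S] unfolding hyperbolic_def by (metis mult.commute)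
qed

subsection \<open>Feasible words\<close>

text \<open>Consuming the first letter, with the letters already used as a parameter, mirrors the
  recursion of \<open>W\<close>.\<close>

fun continuation :: "'a set \<Rightarrow> 'a list \<Rightarrow> bool" where
  "continuation S [] \<longleftrightarrow> True"
| "continuation S (x # \<alpha>) \<longleftrightarrow> x \<in> cont S \<and> continuation (insert x S) \<alpha>"

lemma continuation_iff:
  "continuation S \<alpha> \<longleftrightarrow> set \<alpha> \<subseteq> X - S \<and> distinct \<alpha> \<and>
    (\<forall>i<length \<alpha>. \<forall>y\<in>X. lt y (\<alpha> ! i) \<longrightarrow> y \<in> S \<or> (\<exists>j<i. \<alpha> ! j = y))"
  by (induction \<alpha> arbitrary: S) (auto simp: cont_def All_less_Suc2 Ex_less_Suc2)

lemma feasible_words_eq: "feasible_words X lt = {\<alpha>. continuation {} \<alpha>}"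
  by (auto simp: feasible_words_def feasible_def continuation_iff)

lemma sum_continuation:
  "(\<Sum>\<alpha> | continuation S \<alpha> \<and> length \<alpha> = m. word_weight \<omega> \<alpha>) = W m S"
  (is "sum _ (?C m S) = _")
proof (induction m arbitrary: S)
  case 0
  have "?C 0 S = {[]}" by auto
  then show ?case by (simp add: word_weight_def)
next
  case (Suc m)
  have fin: "finite (?C m T)" for T
    by (rule finite_subset[OF _ finite_lists_length_eq[OF finite_X, of m]]) (auto simp: continuation_iff)
  have "?C (Suc m) S = (\<Union>x\<in>cont S. (#) x ` ?C m (insert x S))"
    by (auto simp: length_Suc_conv image_iff)
  also have "sum (word_weight \<omega>) \<dots> = (\<Sum>x\<in>cont S. sum (word_weight \<omega>) ((#) x ` ?C m (insert x S)))"
    by (rule sum.UNION_disjoint) (auto simp: fin)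
  also have "\<dots> = (\<Sum>x\<in>cont S. \<omega> x * sum (word_weight \<omega>) (?C m (insert x S)))"
    by (simp add: sum.reindex word_weight_def sum_distrib_left)
  also have "\<dots> = W (Suc m) S" by (simp add: Suc.IH)
  finally show ?case .
qed

lemma L_weight_eq: "L_weight (feasible_words X lt) \<omega> m = W m {}"
  by (simp add: L_weight_def feasible_words_eq sum_continuation)

end

theorem theorem1p26:
  fixes X :: "'a set" and lt :: "'a \<Rightarrow> 'a \<Rightarrow> bool" and \<omega> :: "'a \<Rightarrow> real"
    and \<L> :: "'a list set" and n k :: nat
  assumes "finite X" and "card X = n"
    and "strict_poset X lt"
    and "\<L> = feasible_words X lt"
    and "\<And>x. x \<in> X \<Longrightarrow> \<omega> x > 0"
    and "\<And>x. x \<in> X \<Longrightarrow> \<omega> x \<ge> (\<Sum>y\<in>Cov X lt x. \<omega> y)"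
    and "1 \<le> k" and "k < n"
  shows "(L_weight \<L> \<omega> k)\<^sup>2 \<ge> L_weight \<L> \<omega> (k - 1) * L_weight \<L> \<omega> (k + 1)"
proof -
  interpret weighted_poset X lt \<omega>
    using assms by unfold_locales auto
  have "W (k - 1) {} * W (Suc (Suc (k - 1))) {} \<le> (W (Suc (k - 1)) {})\<^sup>2"
    using assms by (intro W_log_concave) (auto simp: lower_def)
  then show ?thesis
    using \<open>1 \<le> k\<close> by (simp add: \<open>\<L> = _\<close> L_weight_eq del: W.simps)
qed

end
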